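(* Let $\mathbf{L}$ be a complete residuated lattice and let $\mathcal{D}_1,\mathcal{D}_2,\mathcal{D}_3,\mathcal{D}_4$ be ranked data tables (RDTs) over $\mathbf{L}$ on arbitrary relation schemes $R_1,R_2,R_3,R_4$, respectively. Put $$R_1'=(R_4\cap(R_1\cup R_2))\cup(R_1\cap R_3),\quad R_2'=R_4\setminus(R_1\cup R_2),\quad R_3'=R_3\cap(R_1\cup R_4),\quad R_4'=R_4\cup(R_1\cap R_3),$$ let $\mathcal{E}_{Q}$ (for a relation scheme $Q$) denote the extended active domain built from the values occurring in $\mathcal{D}_1,\mathcal{D}_2,\mathcal{D}_3,\mathcal{D}_4$, and put $$E=(\mathcal{D}_4\bowtie\mathcal{E}_{R_3'})\Rightarrow^{\mathcal{E}_{R_4'}}(\pi_{R_3'}(\mathcal{D}_3)\bowtie\mathcal{E}_{R_4}).$$ Then for all $r\in\mathrm{Tupl}(R_1\cup R_2)$, $$\bigl(\mathcal{D}_1\div^{\mathcal{D}_3,\mathcal{D}_4}_{\mathrm{gddo}}\mathcal{D}_2\bigr)(r)=\bigl((\mathcal{D}_1\bowtie\mathcal{D}_2)\bowtie(E\div^{\mathcal{E}_{R_1'}}\mathcal{E}_{R_2'})\bigr)(r).$$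
   Context: A complete residuated lattice is $\mathbf{L}=\langle L,\wedge,\vee,\otimes,\rightarrow,0,1\rangle$ where $\langle L,\wedge,\vee,0,1\rangle$ is a complete lattice with least element $0$ and greatest element $1$, $\langle L,\otimes,1\rangle$ is a commutative monoid, and $a\otimes b\le c$ iff $a\le b\rightarrow c$ for all $a,b,c\in L$. Each attribute $y$ has a type (set of values) $D_y$; a relation scheme is a finite set of attributes. $\mathrm{Tupl}(R)=\prod_{y\in R}D_y$; for $r\in\mathrm{Tupl}(R)$ and $S\subseteq R$, $r(S)\in\mathrm{Tupl}(S)$ is the restriction of $r$ to $S$. Tuples $r\in\mathrm{Tupl}(R)$, $s\in\mathrm{Tupl}(S)$ are joinable, written $r\between s$, if $r(R\cap S)=s(R\cap S)$; then $rs$ denotes the tuple $r\cup s\in\mathrm{Tupl}(R\cup S)$. An RDT on $R$ is a map $\mathcal{D}:\mathrm{Tupl}(R)\to L$ with $\{r\mid\mathcal{D}(r)>0\}$ finite. Natural join of $\mathcal{D}$ on $R$ and $\mathcal{D}'$ on $S$: the RDT on $R\cup S$ with $(\mathcal{D}\bowtie\mathcal{D}')(t)=\mathcal{D}(t(R))\otimes\mathcal{D}'(t(S))$. Projection of $\mathcal{D}$ on $R$ onto $S\subseteq R$: $(\pi_S(\mathcal{D}))(s)=\bigvee\{\mathcal{D}(r)\mid r\in\mathrm{Tupl}(R),\ r(S)=s\}$. Residuum with range: for $\mathcal{A},\mathcal{B},\mathcal{C}$ on the same scheme, $(\mathcal{A}\Rightarrow^{\mathcal{C}}\mathcal{B})(t)=\mathcal{C}(t)\otimes(\mathcal{A}(t)\rightarrow\mathcal{B}(t))$.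 Division with range: for $\mathcal{A}$ on $R\cup S$, $\mathcal{B}$ on $S$, $\mathcal{C}$ on $R$ ($R\cap S=\emptyset$), $(\mathcal{A}\div^{\mathcal{C}}\mathcal{B})(r)=\bigwedge_{s\in\mathrm{Tupl}(S)}\bigl(\mathcal{C}(r)\otimes(\mathcal{B}(s)\rightarrow\mathcal{A}(rs))\bigr)$. (Here $R_1'\cap R_2'=\emptyset$ and $R_1'\cup R_2'=R_4'$, which is the scheme of $E$; moreover $R_1'\subseteq R_1\cup R_2$.) Graded Darwen's Divide: for joinable $r_1\in\mathrm{Tupl}(R_1)$, $r_2\in\mathrm{Tupl}(R_2)$, $$\bigl(\mathcal{D}_1\div^{\mathcal{D}_3,\mathcal{D}_4}_{\mathrm{gddo}}\mathcal{D}_2\bigr)(r_1r_2)=\mathcal{D}_1(r_1)\otimes\mathcal{D}_2(r_2)\otimes\bigwedge_{\substack{r_4\in\mathrm{Tupl}(R_4)\\ r_1r_2\between r_4}}\Bigl(\mathcal{D}_4(r_4)\rightarrow\bigvee_{\substack{r_3\in\mathrm{Tupl}(R_3)\\ r_1r_4\between r_3}}\mathcal{D}_3(r_3)\Bigr).$$ Extended active domains: for an attribute $y$, let $A_y$ be the (finite) set of all values $t(y)$ where $t$ is a tuple with non-zero score in one of the given tables $\mathcal{D}_1,\dots,\mathcal{D}_4$ whose scheme contains $y$. For a scheme $Q$, $\mathcal{E}_Q$ is the RDT on $Q$ with $\mathcal{E}_Q(t)=1$ if $t(y)\in A_y$ for all $y\in Q$, and $\mathcal{E}_Q(t)=0$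 otherwise. *)

theory Defs
  imports Main
begin

text \<open>
  The monoid operation of the lattice is \<open>*\<close>, the least element is \<open>bot\<close>,
  and the greatest element \<open>top\<close> is the monoid unit \<open>1\<close>.
\<close>

class complete_residuated_lattice = complete_lattice + comm_monoid_mult +
  fixes residuum :: "'a \<Rightarrow> 'a \<Rightarrow> 'a"  (infixr \<open>\<leadsto>\<close> 60)
  assumes one_eq_top: "1 = top"
    and adjointness: "a * b \<le> c \<longleftrightarrow> a \<le> b \<leadsto> c"

text \<open>
  A tuple is a finite partial function from attributes to values, so that the restriction \<open>r(S)\<close>
  is \<open>r |` S\<close>, and \<open>rs = r \<union> s\<close> is \<open>r ++ s\<close> for joinable \<open>r\<close> and \<open>s\<close>.
  The type (set of values) of the attribute \<open>y\<close> is \<open>ty y\<close>; the sets \<open>ty y\<close> may differ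
  arbitrarily within the common universe \<open>'v\<close>, and may be empty or infinite.
\<close>

type_synonym ('a, 'v) tuple = "'a \<rightharpoonup> 'v"

definition Tupl :: "('a \<Rightarrow> 'v set) \<Rightarrow> 'a set \<Rightarrow> ('a, 'v) tuple set" where
  "Tupl ty R = {r. dom r = R \<and> (\<forall>y\<in>R. the (r y) \<in> ty y)}"

definition joinable :: "('a, 'v) tuple \<Rightarrow> ('a, 'v) tuple \<Rightarrow> bool" where
  "joinable r s \<longleftrightarrow> r |` (dom r \<inter> dom s) = s |` (dom r \<inter> dom s)"

text \<open>
  A table carries its relation scheme. Only the scores of tuples on that scheme are
  meaningful; no definition below reads any other value of \<open>score\<close>.
\<close>

datatype ('a, 'v, 'l) table =
  Table (scheme: "'a set") (score: "('a, 'v) tuple \<Rightarrow> 'l")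

definition rdt_on ::
  "('a \<Rightarrow> 'v set) \<Rightarrow> 'a set \<Rightarrow> ('a, 'v, 'l::complete_residuated_lattice) table \<Rightarrow> bool" where
  "rdt_on ty R T \<longleftrightarrow> finite R \<and> scheme T = R \<and> finite {r \<in> Tupl ty R. score T r > bot}"

definition natural_join ::
  "('a, 'v, 'l::complete_residuated_lattice) table \<Rightarrow> ('a, 'v, 'l) table \<Rightarrow> ('a, 'v, 'l) table"
  (infixl \<open>\<bowtie>\<close> 70) where
  "A \<bowtie> B = Table (scheme A \<union> scheme B)
     (\<lambda>t. score A (t |` scheme A) * score B (t |` scheme B))"

text \<open>Intended for \<open>S \<subseteq> scheme A\<close>.\<close>

definition projection ::
  "('a \<Rightarrow> 'v set) \<Rightarrow> 'a set \<Rightarrow> ('a, 'v, 'l::complete_residuated_lattice) table \<Rightarrow> ('a, 'v, 'l) table"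
  where
  "projection ty S A = Table S
     (\<lambda>s. SUP r\<in>{r \<in> Tupl ty (scheme A). r |` S = s}. score A r)"

text \<open>The table of \<open>A \<Rightarrow> B\<close> with range \<open>C\<close>, where all three have the same scheme.\<close>

definition residuum_range ::
  "('a, 'v, 'l::complete_residuated_lattice) table \<Rightarrow> ('a, 'v, 'l) table \<Rightarrow> ('a, 'v, 'l) table
    \<Rightarrow> ('a, 'v, 'l) table" where
  "residuum_range C A B = Table (scheme C)
     (\<lambda>t. score C t * (score A t \<leadsto> score B t))"

text \<open>
  The table of \<open>A \<div> B\<close> with range \<open>C\<close>, where \<open>scheme B\<close> and \<open>scheme C\<close>
  are disjoint and their union is \<open>scheme A\<close>.
\<close>

definition division_range ::
  "('a \<Rightarrow> 'v set) \<Rightarrow> ('a, 'v, 'l::complete_residuated_lattice) table \<Rightarrow> ('a, 'v, 'l) table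
    \<Rightarrow> ('a, 'v, 'l) table \<Rightarrow> ('a, 'v, 'l) table" where
  "division_range ty C A B = Table (scheme C)
     (\<lambda>r. INF s\<in>Tupl ty (scheme B). score C r * (score B s \<leadsto> score A (r ++ s)))"

text \<open>
  The graded Darwen's Divide of \<open>D\<^sub>1\<close> by \<open>D\<^sub>2\<close> with mediators \<open>D\<^sub>3\<close>, \<open>D\<^sub>4\<close>. Every tuple \<open>r\<close> on the
  union of the first two schemes is \<open>r\<^sub>1 r\<^sub>2\<close> for exactly one joinable pair, its restrictions.
\<close>

definition gddo ::
  "('a \<Rightarrow> 'v set) \<Rightarrow> ('a, 'v, 'l::complete_residuated_lattice) table \<Rightarrow> ('a, 'v, 'l) table
    \<Rightarrow> ('a, 'v, 'l) table \<Rightarrow> ('a, 'v, 'l) table \<Rightarrow> ('a, 'v, 'l) table" where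
  "gddo ty D\<^sub>1 D\<^sub>2 D\<^sub>3 D\<^sub>4 = Table (scheme D\<^sub>1 \<union> scheme D\<^sub>2)
     (\<lambda>r. let r\<^sub>1 = r |` scheme D\<^sub>1; r\<^sub>2 = r |` scheme D\<^sub>2 in
        score D\<^sub>1 r\<^sub>1 * score D\<^sub>2 r\<^sub>2 *
        (INF r\<^sub>4\<in>{r\<^sub>4 \<in> Tupl ty (scheme D\<^sub>4). joinable (r\<^sub>1 ++ r\<^sub>2) r\<^sub>4}.
           score D\<^sub>4 r\<^sub>4 \<leadsto>
           (SUP r\<^sub>3\<in>{r\<^sub>3 \<in> Tupl ty (scheme D\<^sub>3). joinable (r\<^sub>1 ++ r\<^sub>4) r\<^sub>3}. score D\<^sub>3 r\<^sub>3)))"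

definition active_values ::
  "('a \<Rightarrow> 'v set) \<Rightarrow> ('a, 'v, 'l::complete_residuated_lattice) table set \<Rightarrow> 'a \<Rightarrow> 'v set" where
  "active_values ty Ts y =
     {the (t y) | t T. T \<in> Ts \<and> y \<in> scheme T \<and> t \<in> Tupl ty (scheme T) \<and> score T t > bot}"

definition extended_active_domain ::
  "('a \<Rightarrow> 'v set) \<Rightarrow> ('a, 'v, 'l::complete_residuated_lattice) table set \<Rightarrow> 'a set
    \<Rightarrow> ('a, 'v, 'l) table" where
  "extended_active_domain ty Ts Q = Table Q
     (\<lambda>t. if \<forall>y\<in>Q. the (t y) \<in> active_values ty Ts y then top else bot)"

end

theory Submission
  imports Defs
begin

text \<open>
  If \<open>D\<^sub>1\<close> or \<open>D\<^sub>2\<close> vanishes on its part of \<open>r\<close>, both sides are \<open>bot\<close>. Otherwise all values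
  of \<open>r\<close> are active. The tuples \<open>r\<^sub>4\<close> joinable with \<open>r\<close> are the restrictions \<open>(r ++ s) |` R\<^sub>4\<close>
  for \<open>s\<close> on \<open>R\<^sub>4 - (R\<^sub>1 \<union> R\<^sub>2)\<close>, so both infima range over the same \<open>s\<close>. If \<open>s\<close> has an inactive
  value, then both terms are \<open>top\<close>, because \<open>D\<^sub>4\<close> vanishes on \<open>(r ++ s) |` R\<^sub>4\<close>. If all its values are
  active, every active domain involved is \<open>top\<close>, and both terms agree because \<open>r\<^sub>3\<close> is joinable
  with \<open>r\<^sub>1r\<^sub>4\<close> exactly if it projects to \<open>(r ++ s) |` (R\<^sub>3 \<inter> (R\<^sub>1 \<union> R\<^sub>4))\<close>.
\<close>

lemma bot_mult [simp]: "bot * a = (bot::'l::complete_residuated_lattice)"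
  by (metis adjointness bot.extremum bot.extremum_uniqueI)

lemma mult_bot [simp]: "a * bot = (bot::'l::complete_residuated_lattice)"
  by (metis bot_mult mult.commute)

lemma top_mult [simp]: "top * a = (a::'l::complete_residuated_lattice)"
  by (metis one_eq_top mult_1)

lemma mult_top [simp]: "a * top = (a::'l::complete_residuated_lattice)"
  by (metis one_eq_top mult_1_right)

lemma bot_residuum [simp]: "(bot::'l::complete_residuated_lattice) \<leadsto> a = top"
  by (metis adjointness bot.extremum mult_bot top.extremum_uniqueI)

lemma top_residuum [simp]: "top \<leadsto> a = (a::'l::complete_residuated_lattice)"
  by (metis adjointness mult_top order_antisym order_refl)

lemma score_extended_active_domain:
  "score (extended_active_domain ty Ts Q) t =
     (if \<forall>y\<in>Q. the (t y) \<in> active_values ty Ts y then top else bot)"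
  by (simp add: extended_active_domain_def)

lemma scheme_extended_active_domain [simp]: "scheme (extended_active_domain ty Ts Q) = Q"
  by (simp add: extended_active_domain_def)

lemma score_inactive:
  assumes "T \<in> Ts" "t \<in> Tupl ty (scheme T)" "y \<in> scheme T"
    and "the (t y) \<notin> active_values ty Ts y"
  shows "score T t = bot"
  using assms unfolding active_values_def by (metis (mono_tags, lifting) bot.not_eq_extremum mem_Collect_eq)

lemma Tupl_dom: "r \<in> Tupl ty R \<Longrightarrow> dom r = R"
  by (simp add: Tupl_def)

lemma Tupl_restrict: "r \<in> Tupl ty R \<Longrightarrow> S \<subseteq> R \<Longrightarrow> r |` S \<in> Tupl ty S"
  by (auto simp: Tupl_def)

lemma Tupl_map_add: "r \<in> Tupl ty R \<Longrightarrow> s \<in> Tupl ty S \<Longrightarrow> r ++ s \<in> Tupl ty (R \<union> S)"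
  unfolding Tupl_def by (fastforce simp: map_add_def dom_def split: option.splits)

lemma restrict_map_add_Un: "m |` A ++ m |` B = m |` (A \<union> B)"
  by (auto simp: fun_eq_iff map_add_def restrict_map_def split: option.splits)

lemma restrict_map_superset: "dom r \<subseteq> R \<Longrightarrow> r |` R = r"
  unfolding restrict_map_def by (rule ext) (metis domIff subsetD)

lemma map_add_restrict_dom:
  assumes "dom r \<inter> dom s = {}"
  shows "(r ++ s) |` dom r = r"
proof
  fix x show "((r ++ s) |` dom r) x = r x"
    using assms by (cases "x \<in> dom r") (auto simp: map_add_def restrict_map_def split: option.splits)
qed

text \<open>Agreement with \<open>r\<close> fixes the values on \<open>R \<inter> S\<close>, so only
  the part on \<open>S - R\<close> is free. This lets an infimum over joinable tuples be reindexed
  by the tuples that the division ranges over.\<close>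

lemma joinable_tuples:
  assumes r: "r \<in> Tupl ty R"
  shows "{q \<in> Tupl ty S. joinable r q} = (\<lambda>s. (r ++ s) |` S) ` Tupl ty (S - R)"
proof (intro equalityI subsetI)
  fix q assume "q \<in> {q \<in> Tupl ty S. joinable r q}"
  then have q: "q \<in> Tupl ty S" and j: "r |` (R \<inter> S) = q |` (R \<inter> S)"
    by (auto simp: joinable_def Tupl_dom[OF r] Tupl_dom)
  \<comment> \<open>The witness is the part of \<open>q\<close> outside \<open>R\<close>; on
    \<open>R \<inter> S\<close> the values come from \<open>r\<close> by joinability.\<close>
  have "q = (r ++ q |` (S - R)) |` S"
  proof
    fix x
    show "q x = ((r ++ q |` (S - R)) |` S) x"
    proof (cases "x \<in> R")
      case True
      then show ?thesis
        using fun_cong[OF j, of x] Tupl_dom[OF q]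
        by (auto simp: restrict_map_def map_add_def split: if_splits)
    next
      case False
      moreover have "x \<notin> dom r" "x \<notin> S \<Longrightarrow> x \<notin> dom q"
        using False Tupl_dom[OF r] Tupl_dom[OF q] by auto
      ultimately show ?thesis
        by (auto simp: restrict_map_def map_add_def domIff split: option.splits)
    qed
  qed
  moreover have "q |` (S - R) \<in> Tupl ty (S - R)"
    using q by (rule Tupl_restrict) auto
  ultimately show "q \<in> (\<lambda>s. (r ++ s) |` S) ` Tupl ty (S - R)"
    by blast
next
  fix q assume "q \<in> (\<lambda>s. (r ++ s) |` S) ` Tupl ty (S - R)"
  then obtain s where s: "s \<in> Tupl ty (S - R)" and q: "q = (r ++ s) |` S"
    by blast
  have "r ++ s \<in> Tupl ty (R \<union> S)"
    using Tupl_map_add[OF r s] by simp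
  then have T: "q \<in> Tupl ty S"
    unfolding q by (rule Tupl_restrict) auto
  have "(r ++ s) |` R = r"
    using map_add_restrict_dom[of r s] Tupl_dom[OF r] Tupl_dom[OF s] by auto
  then have "r |` (R \<inter> S) = q |` (R \<inter> S)"
    unfolding q by (metis Int_left_absorb Int_commute restrict_restrict)
  then show "q \<in> {q \<in> Tupl ty S. joinable r q}"
    using T by (simp add: joinable_def Tupl_dom[OF r] Tupl_dom[OF T])
qed

theorem theorem12:
  fixes ty :: "'a \<Rightarrow> 'v set"
    and D\<^sub>1 D\<^sub>2 D\<^sub>3 D\<^sub>4 E :: "('a, 'v, 'l::complete_residuated_lattice) table"
    and R\<^sub>1 R\<^sub>2 R\<^sub>3 R\<^sub>4 R\<^sub>1' R\<^sub>2' R\<^sub>3' R\<^sub>4' :: "'a set"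
    and \<E> :: "'a set \<Rightarrow> ('a, 'v, 'l) table"
  assumes "rdt_on ty R\<^sub>1 D\<^sub>1" and "rdt_on ty R\<^sub>2 D\<^sub>2" and "rdt_on ty R\<^sub>3 D\<^sub>3" and "rdt_on ty R\<^sub>4 D\<^sub>4"
    and "R\<^sub>1' = (R\<^sub>4 \<inter> (R\<^sub>1 \<union> R\<^sub>2)) \<union> (R\<^sub>1 \<inter> R\<^sub>3)"
    and "R\<^sub>2' = R\<^sub>4 - (R\<^sub>1 \<union> R\<^sub>2)"
    and "R\<^sub>3' = R\<^sub>3 \<inter> (R\<^sub>1 \<union> R\<^sub>4)"
    and "R\<^sub>4' = R\<^sub>4 \<union> (R\<^sub>1 \<inter> R\<^sub>3)"
    and "\<E> = extended_active_domain ty {D\<^sub>1, D\<^sub>2, D\<^sub>3, D\<^sub>4}"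
    and "E = residuum_range (\<E> R\<^sub>4') (D\<^sub>4 \<bowtie> \<E> R\<^sub>3') (projection ty R\<^sub>3' D\<^sub>3 \<bowtie> \<E> R\<^sub>4)"
  shows "\<forall>r \<in> Tupl ty (R\<^sub>1 \<union> R\<^sub>2).
    score (gddo ty D\<^sub>1 D\<^sub>2 D\<^sub>3 D\<^sub>4) r =
    score ((D\<^sub>1 \<bowtie> D\<^sub>2) \<bowtie> division_range ty (\<E> R\<^sub>1') E (\<E> R\<^sub>2')) r"
proof
  fix r assume r: "r \<in> Tupl ty (R\<^sub>1 \<union> R\<^sub>2)"
  let ?Ts = "{D\<^sub>1, D\<^sub>2, D\<^sub>3, D\<^sub>4}"
  define act where "act Q t \<longleftrightarrow> (\<forall>y\<in>Q. the (t y) \<in> active_values ty ?Ts y)"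
    for Q and t :: "('a, 'v) tuple"
  have sch [simp]: "scheme D\<^sub>1 = R\<^sub>1" "scheme D\<^sub>2 = R\<^sub>2" "scheme D\<^sub>3 = R\<^sub>3" "scheme D\<^sub>4 = R\<^sub>4"
    using assms(1-4) by (auto simp: rdt_on_def)
  have scE: "score (\<E> Q) t = (if act Q t then top else bot)" and schE [simp]: "scheme (\<E> Q) = Q"
    for Q t
    by (simp_all add: assms(9) score_extended_active_domain act_def)
  have inact: "score T t = bot" if "T \<in> ?Ts" "t \<in> Tupl ty (scheme T)" "\<not> act (scheme T) t" for T t
    using that score_inactive[of T ?Ts t ty] unfolding act_def by blast
  \<comment> \<open>Activity on \<open>Q\<close> reads only values on \<open>Q\<close>, so it passes
    freely between a tuple and its restrictions.\<close>
  have act_restrict: "act Q (t |` P) \<longleftrightarrow> act Q t" if "Q \<subseteq> P" for Q P t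
    using that by (auto simp: act_def restrict_map_def)
  have r_id: "r |` (R\<^sub>1 \<union> R\<^sub>2) = r"
    using Tupl_dom[OF r] by (simp add: restrict_map_superset)
  have r12: "r |` R\<^sub>1 ++ r |` R\<^sub>2 = r"
    by (simp add: restrict_map_add_Un r_id)
  let ?d = "score D\<^sub>1 (r |` R\<^sub>1) * score D\<^sub>2 (r |` R\<^sub>2)"
  let ?L = "INF r\<^sub>4\<in>{r\<^sub>4 \<in> Tupl ty R\<^sub>4. joinable r r\<^sub>4}. score D\<^sub>4 r\<^sub>4 \<leadsto>
           (SUP r\<^sub>3\<in>{r\<^sub>3 \<in> Tupl ty R\<^sub>3. joinable (r |` R\<^sub>1 ++ r\<^sub>4) r\<^sub>3}. score D\<^sub>3 r\<^sub>3)"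
  let ?r' = "r |` R\<^sub>1'"
  let ?R = "INF s\<in>Tupl ty R\<^sub>2'. score (\<E> R\<^sub>1') ?r' * (score (\<E> R\<^sub>2') s \<leadsto> score E (?r' ++ s))"
  have lhs: "score (gddo ty D\<^sub>1 D\<^sub>2 D\<^sub>3 D\<^sub>4) r = ?d * ?L"
    by (simp add: gddo_def Let_def r12)
  have rhs: "score ((D\<^sub>1 \<bowtie> D\<^sub>2) \<bowtie> division_range ty (\<E> R\<^sub>1') E (\<E> R\<^sub>2')) r = ?d * ?R"
    by (simp add: natural_join_def division_range_def r_id)
  show "score (gddo ty D\<^sub>1 D\<^sub>2 D\<^sub>3 D\<^sub>4) r =
    score ((D\<^sub>1 \<bowtie> D\<^sub>2) \<bowtie> division_range ty (\<E> R\<^sub>1') E (\<E> R\<^sub>2')) r"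
  \<comment> \<open>The range factor \<open>score (\<E> R\<^sub>1') ?r'\<close> has no counterpart
    in \<open>?L\<close>. Either \<open>?d\<close> is \<open>bot\<close> and the factor is
    irrelevant, or it is \<open>top\<close>, since \<open>R\<^sub>1'\<close> lies within
    \<open>R\<^sub>1 \<union> R\<^sub>2\<close>.\<close>
  proof (cases "act (R\<^sub>1 \<union> R\<^sub>2) r")
    case False
    then have "\<not> act R\<^sub>1 (r |` R\<^sub>1) \<or> \<not> act R\<^sub>2 (r |` R\<^sub>2)"
      unfolding act_restrict[OF order_refl] by (auto simp: act_def)
    moreover have "r |` R\<^sub>1 \<in> Tupl ty R\<^sub>1" "r |` R\<^sub>2 \<in> Tupl ty R\<^sub>2"
      using r by (auto intro: Tupl_restrict)
    ultimately have "score D\<^sub>1 (r |` R\<^sub>1) = bot \<or> score D\<^sub>2 (r |` R\<^sub>2) = bot"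
      using inact[of D\<^sub>1 "r |` R\<^sub>1"] inact[of D\<^sub>2 "r |` R\<^sub>2"] by auto
    then have "?d = bot"
      by auto
    then show ?thesis
      by (simp only: lhs rhs bot_mult)
  next
    case True
    have "?L = (INF s\<in>Tupl ty R\<^sub>2'. score D\<^sub>4 ((r ++ s) |` R\<^sub>4) \<leadsto>
       (SUP r\<^sub>3\<in>{r\<^sub>3 \<in> Tupl ty R\<^sub>3. joinable (r |` R\<^sub>1 ++ (r ++ s) |` R\<^sub>4) r\<^sub>3}. score D\<^sub>3 r\<^sub>3))"
      by (simp only: joinable_tuples[OF r] image_image assms(6))
    also have "\<dots> = ?R"
    proof (rule INF_cong[OF refl])
      fix s assume s: "s \<in> Tupl ty R\<^sub>2'"
      \<comment> \<open>Every tuple at which a table is evaluated for this \<open>s\<close> is a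
        restriction of \<open>u\<close>, so the remaining bookkeeping reduces to identities between
        schemes.\<close>
      define u where "u = r ++ s"
      have disj: "dom r \<inter> dom s = {}"
        using Tupl_dom[OF r] Tupl_dom[OF s] assms(6) by auto
      have u: "u \<in> Tupl ty (R\<^sub>1 \<union> R\<^sub>2 \<union> R\<^sub>4)"
        using Tupl_map_add[OF r s] by (simp add: u_def assms(6))
      have u4: "u |` R\<^sub>4 \<in> Tupl ty R\<^sub>4"
        using u by (rule Tupl_restrict) auto
      have ur: "u |` (R\<^sub>1 \<union> R\<^sub>2) = r"
        using map_add_restrict_dom[OF disj] Tupl_dom[OF r] by (simp add: u_def)
      \<comment> \<open>Disjoint domains allow \<open>r\<close> and \<open>s\<close> to be swapped,
        which makes \<open>s\<close> the left operand.\<close>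
      have us: "u |` R\<^sub>2' = s"
        using map_add_restrict_dom[of s r] map_add_comm[OF disj] disj Tupl_dom[OF s]
        by (auto simp: u_def)
      have u1: "r |` R\<^sub>1 = u |` R\<^sub>1"
        unfolding ur[symmetric] by (simp add: Int_absorb1)
      have ur': "?r' = u |` R\<^sub>1'"
        unfolding ur[symmetric] by (simp add: assms(5)) (rule arg_cong[where f = "restrict_map u"], auto)
      \<comment> \<open>This rests on
        \<open>R\<^sub>1' \<union> R\<^sub>2' = R\<^sub>4'\<close>.\<close>
      have t: "?r' ++ s = u |` R\<^sub>4'"
        unfolding ur' us[symmetric] restrict_map_add_Un
        by (rule arg_cong[where f = "restrict_map u"]) (auto simp: assms(5-8))
      have act_r: "act R\<^sub>1' ?r'"
        using True act_restrict[OF order_refl, of R\<^sub>1' r] by (auto simp: act_def assms(5))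
      have act_u12: "act (R\<^sub>1 \<union> R\<^sub>2) u"
        using True act_restrict[OF order_refl, of "R\<^sub>1 \<union> R\<^sub>2" u] ur by simp
      have act_s: "act R\<^sub>2' s \<longleftrightarrow> act R\<^sub>2' u"
        using act_restrict[OF order_refl, of R\<^sub>2' u] us by simp
      show "(score D\<^sub>4 ((r ++ s) |` R\<^sub>4) \<leadsto>
          (SUP r\<^sub>3\<in>{r\<^sub>3 \<in> Tupl ty R\<^sub>3. joinable (r |` R\<^sub>1 ++ (r ++ s) |` R\<^sub>4) r\<^sub>3}. score D\<^sub>3 r\<^sub>3)) =
        score (\<E> R\<^sub>1') ?r' * (score (\<E> R\<^sub>2') s \<leadsto> score E (?r' ++ s))"
      proof (cases "act R\<^sub>2' s")
        case False
        \<comment> \<open>The inactive value sits at an attribute of \<open>R\<^sub>2'\<close>,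
          which is contained in \<open>R\<^sub>4\<close>. Both residua then have \<open>bot\<close>
          on the left.\<close>
        then have "\<not> act R\<^sub>4 (u |` R\<^sub>4)"
          unfolding act_s act_restrict[OF order_refl] by (auto simp: act_def assms(6))
        then have "score D\<^sub>4 (u |` R\<^sub>4) = bot"
          using inact[of D\<^sub>4] u4 by simp
        then show ?thesis
          using False act_r by (simp add: u_def[symmetric] scE)
      next
        case act_s_true: True
        have act_u: "act (R\<^sub>1 \<union> R\<^sub>2 \<union> R\<^sub>4) u"
          using act_s_true act_u12 unfolding act_s by (auto simp: act_def assms(6))
        have act_sub: "act Q (u |` Q)" if "Q \<subseteq> R\<^sub>1 \<union> R\<^sub>2 \<union> R\<^sub>4" for Q
          using act_u that unfolding act_restrict[OF order_refl] by (auto simp: act_def)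
        have sub: "R\<^sub>3' \<subseteq> R\<^sub>4'" "R\<^sub>4 \<subseteq> R\<^sub>4'" "R\<^sub>4' \<subseteq> R\<^sub>1 \<union> R\<^sub>2 \<union> R\<^sub>4" "R\<^sub>3' \<subseteq> R\<^sub>1 \<union> R\<^sub>2 \<union> R\<^sub>4"
          by (auto simp: assms(7,8))
        \<comment> \<open>The two domains overlap exactly in \<open>R\<^sub>3'\<close>, so
          joinability becomes the condition under the supremum that defines the projection.\<close>
        have join: "joinable (u |` (R\<^sub>1 \<union> R\<^sub>4)) r\<^sub>3 \<longleftrightarrow> r\<^sub>3 |` R\<^sub>3' = u |` R\<^sub>3'"
          if r3: "r\<^sub>3 \<in> Tupl ty R\<^sub>3" for r\<^sub>3
        proof -
          have "dom (u |` (R\<^sub>1 \<union> R\<^sub>4)) \<inter> dom r\<^sub>3 = R\<^sub>3'"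
            using Tupl_dom[OF u] Tupl_dom[OF r3] by (auto simp: assms(7))
          moreover have "(R\<^sub>1 \<union> R\<^sub>4) \<inter> R\<^sub>3' = R\<^sub>3'"
            by (auto simp: assms(7))
          ultimately show ?thesis
            by (auto simp: joinable_def)
        qed
        \<comment> \<open>All three active domains in \<open>E\<close> are \<open>top\<close> here,
          because their schemes lie in the domain of \<open>u\<close>, where every value is
          active.\<close>
        have "score E (u |` R\<^sub>4') = (score D\<^sub>4 (u |` R\<^sub>4) \<leadsto> score (projection ty R\<^sub>3' D\<^sub>3) (u |` R\<^sub>3'))"
          using sub act_sub[of "R\<^sub>4'"] act_sub[of "R\<^sub>3'"] act_sub[of "R\<^sub>4"]
          by (simp add: assms(10) residuum_range_def natural_join_def scE projection_def Int_absorb1)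
        also have "score (projection ty R\<^sub>3' D\<^sub>3) (u |` R\<^sub>3') =
          (SUP r\<^sub>3\<in>{r\<^sub>3 \<in> Tupl ty R\<^sub>3. joinable (u |` (R\<^sub>1 \<union> R\<^sub>4)) r\<^sub>3}. score D\<^sub>3 r\<^sub>3)"
          using join by (auto simp: projection_def intro!: SUP_cong)
        finally show ?thesis
          using act_s_true act_r
          by (simp add: u_def[symmetric] scE t u1 restrict_map_add_Un)
      qed
    qed
    finally show ?thesis
      by (simp only: lhs rhs)
  qed
qed

end
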